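(* Let $\mathcal H$ be a real Hilbert space, $h>0$, $\gamma>0$, $\beta\ge0$. Let $f\in C^1(\mathcal H)$ be real-valued with $\inf_{\mathcal H}f>-\infty$ and $\nabla f$ globally $L$-Lipschitz continuous, $L\ge0$. Let $\phi:\mathcal H\to\mathbb R\cup\{+\infty\}$ be proper, lower semicontinuous and convex with $\phi(0)=\min\phi=0$ and $r\mathbb B\subseteq\partial\phi(0)$ for some $r>0$. Let $(x_k,v_k)_{k\ge0}$ satisfy, from some $x_0,v_0\in\mathcal H$, $$\frac{v_{k+1}-v_k}{h}+\gamma v_{k+1}+\partial\phi(v_{k+1})+\nabla f(x_k+\beta v_k)\ni0,\qquad \frac{x_{k+1}-x_k}{h}=v_{k+1}\qquad(k\ge0).$$ Set $y_k=x_k+\beta v_k$, $d_{k+1}=v_{k+1}-v_k$ and $$\mathcal E_k^h=f(y_k)-\inf_{\mathcal H}f+\frac{1+\beta\gamma}{2}\|v_k\|^2+\beta\phi(v_k).$$ If $v_k\in\mathrm{dom}(\phi)$, then $$\mathcal E_{k+1}^h-\mathcal E_k^h+h\phi(v_{k+1})+Q_h(v_{k+1},d_{k+1})\le0,$$ where $Q_h(v,d)=A_h\|v\|^2+C_h\|d\|^2-Lh\beta\langle v,d\rangle$ with $$A_h=h\gamma-\frac{Lh^2}{2},\qquad C_h=\frac12+\frac{\beta}{h}+\frac{\beta\gamma}{2}-\frac{L\beta^2}{2}.$$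
   Context: $\mathbb B$ is the closed unit ball, $\partial\phi$ the convex subdifferential, $\mathrm{dom}(\phi)=\{v:\phi(v)<+\infty\}$. The recursion has a unique solution: $v_{k+1}=\mathrm{prox}_{\lambda_h\phi}\bigl(\frac{1}{1+h\gamma}v_k-\lambda_h\nabla f(x_k+\beta v_k)\bigr)$ with $\lambda_h=\frac{h}{1+h\gamma}$. When $\beta=0$ the term $\beta\phi(v_k)$ is omitted (not interpreted as $0\cdot(+\infty)$). *)

theory Defs
  imports "HOL-Analysis.Analysis"
begin

text \<open>
  Functions with values in the extended half-line \<open>(-\<infinity>, +\<infinity>]\<close> are rendered as functions into
  \<^typ>\<open>ereal\<close>; properness rules out the value \<open>-\<infinity>\<close>.
\<close>

definition effective_domain :: "('a \<Rightarrow> ereal) \<Rightarrow> 'a set" where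
  "effective_domain \<phi> = {v. \<phi> v < \<infinity>}"

definition proper_fun :: "('a \<Rightarrow> ereal) \<Rightarrow> bool" where
  "proper_fun \<phi> \<longleftrightarrow> (\<forall>v. \<phi> v \<noteq> -\<infinity>) \<and> effective_domain \<phi> \<noteq> {}"

definition lower_semicontinuous :: "('a::topological_space \<Rightarrow> ereal) \<Rightarrow> bool" where
  "lower_semicontinuous \<phi> \<longleftrightarrow> (\<forall>v. \<phi> v \<le> Liminf (at v) \<phi>)"

text \<open>
  The weights are kept in the open interval \<open>(0, 1)\<close>, so that no product \<open>0 \<cdot> \<infinity>\<close> occurs; the sum on
  the right is meaningful for functions that do not take the value \<open>-\<infinity>\<close>.
\<close>

definition convex_fun :: "('a::real_vector \<Rightarrow> ereal) \<Rightarrow> bool" where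
  "convex_fun \<phi> \<longleftrightarrow>
    (\<forall>u w. \<forall>t::real. 0 < t \<longrightarrow> t < 1 \<longrightarrow>
      \<phi> ((1 - t) *\<^sub>R u + t *\<^sub>R w) \<le> ereal (1 - t) * \<phi> u + ereal t * \<phi> w)"

text \<open>
  For a proper function the subdifferential is empty outside the effective domain, since there the
  left-hand side of the inequality is \<open>\<infinity>\<close>.
\<close>

definition subdifferential :: "('a::real_inner \<Rightarrow> ereal) \<Rightarrow> 'a \<Rightarrow> 'a set" where
  "subdifferential \<phi> v = {\<xi>. \<forall>w. \<phi> v + ereal (\<xi> \<bullet> (w - v)) \<le> \<phi> w}"

text \<open>
  The energy at position \<open>x\<close> and velocity \<open>v\<close>. The infimum is the conditionally complete one on
  \<^typ>\<open>real\<close>, hence meaningful only when \<open>f\<close> is bounded below.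
  For \<open>\<beta> = 0\<close> the term \<open>\<beta> \<phi>(v)\<close> is absent.
\<close>

definition energy ::
  "('a::real_inner \<Rightarrow> real) \<Rightarrow> ('a \<Rightarrow> ereal) \<Rightarrow> real \<Rightarrow> real \<Rightarrow> 'a \<Rightarrow> 'a \<Rightarrow> ereal" where
  "energy f \<phi> \<beta> \<gamma> x v =
    ereal (f (x + \<beta> *\<^sub>R v) - (INF z. f z) + (1 + \<beta> * \<gamma>) / 2 * (norm v)\<^sup>2)
      + (if \<beta> = 0 then 0 else ereal \<beta> * \<phi> v)"

definition coeff_A :: "real \<Rightarrow> real \<Rightarrow> real \<Rightarrow> real" where
  "coeff_A L \<gamma> h = h * \<gamma> - L * h\<^sup>2 / 2"

definition coeff_C :: "real \<Rightarrow> real \<Rightarrow> real \<Rightarrow> real \<Rightarrow> real" where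
  "coeff_C L \<beta> \<gamma> h = 1 / 2 + \<beta> / h + \<beta> * \<gamma> / 2 - L * \<beta>\<^sup>2 / 2"

definition quad_Q :: "real \<Rightarrow> real \<Rightarrow> real \<Rightarrow> real \<Rightarrow> 'a::real_inner \<Rightarrow> 'a \<Rightarrow> real" where
  "quad_Q L \<beta> \<gamma> h v d =
    coeff_A L \<gamma> h * (norm v)\<^sup>2 + coeff_C L \<beta> \<gamma> h * (norm d)\<^sup>2 - L * h * \<beta> * (v \<bullet> d)"

end

theory Submission
  imports Defs
begin

text \<open>
  The descent lemma bounds \<open>f(y\<^bsub>k+1\<^esub>) - f(y\<^bsub>k\<^esub>)\<close> along the step \<open>h v\<^bsub>k+1\<^esub> + \<beta> d\<^bsub>k+1\<^esub>\<close>. In that bound the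
  gradient is replaced by means of the inclusion, and the resulting subgradient terms are estimated
  by testing the subgradient inequality at \<open>v\<^bsub>k+1\<^esub>\<close> against \<open>0\<close> and against \<open>v\<^bsub>k\<^esub>\<close>. The mixed terms
  \<open>(1 + \<beta>\<gamma>) \<langle>v\<^bsub>k+1\<^esub>, d\<^bsub>k+1\<^esub>\<rangle>\<close> cancel against the increment of the kinetic energy.
\<close>

text \<open>Along the segment from \<open>y\<close> to \<open>y + w\<close>, subtract the linear
  term and the quadratic bound from \<open>f\<close>. By Cauchy-Schwarz and the Lipschitz bound, the
  resulting \<open>F\<close> has nonpositive derivative for \<open>t \<ge> 0\<close>, so
  \<open>F 1 \<le> F 0\<close>.\<close>

lemma descent_lemma:
  fixes f :: "'a::real_inner \<Rightarrow> real"
  assumes grad: "\<And>z. GDERIV f z :> g z"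
    and lip: "L-lipschitz_on UNIV g"
  shows "f (y + w) \<le> f y + g y \<bullet> w + L / 2 * (norm w)\<^sup>2"
proof -
  define F where "F t = f (y + t *\<^sub>R w) - t * (g y \<bullet> w) - L / 2 * t\<^sup>2 * (norm w)\<^sup>2" for t :: real
  have deriv: "(F has_real_derivative
      (g (y + t *\<^sub>R w) - g y) \<bullet> w - L * t * (norm w)\<^sup>2) (at t)" for t
  proof -
    have f': "(f has_derivative (\<lambda>u. u \<bullet> g (y + t *\<^sub>R w))) (at (y + t *\<^sub>R w))"
      using grad by (simp add: gderiv_def inner_commute)
    have "((\<lambda>t. y + t *\<^sub>R w) has_derivative (\<lambda>s. s *\<^sub>R w)) (at t)"
      by (auto intro!: derivative_eq_intros)
    from has_derivative_compose[OF this f']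
    have "((\<lambda>t. f (y + t *\<^sub>R w)) has_real_derivative g (y + t *\<^sub>R w) \<bullet> w) (at t)"
      by (simp add: has_field_derivative_def inner_commute mult.commute[of _ "_ \<bullet> _"])
    then show ?thesis
      unfolding F_def
      by (auto intro!: derivative_eq_intros simp: inner_diff_left algebra_simps)
  qed
  have "(g (y + t *\<^sub>R w) - g y) \<bullet> w - L * t * (norm w)\<^sup>2 \<le> 0" if "0 \<le> t" for t
  proof -
    have "(g (y + t *\<^sub>R w) - g y) \<bullet> w \<le> norm (g (y + t *\<^sub>R w) - g y) * norm w"
      by (rule norm_cauchy_schwarz)
    also have "\<dots> \<le> (L * (t * norm w)) * norm w"
      using lipschitz_onD[OF lip, of "y + t *\<^sub>R w" y] that
      by (intro mult_right_mono) (auto simp: dist_norm)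
    finally show ?thesis
      by (simp add: power2_eq_square algebra_simps)
  qed
  with deriv have "F 1 \<le> F 0"
    by (intro DERIV_nonpos_imp_nonincreasing[of 0 1 F]) (simp, blast)
  then show ?thesis
    by (simp add: F_def)
qed

text \<open>An infinite value at \<open>v\<close> would force \<open>\<phi>\<close> to be infinite
  everywhere, against properness. This makes the value at each new velocity finite.\<close>

lemma subgradient_imp_effective_domain:
  assumes "proper_fun \<phi>" and "\<xi> \<in> subdifferential \<phi> v"
  shows "v \<in> effective_domain \<phi>"
proof -
  obtain w where "\<phi> w < \<infinity>"
    using assms(1) by (auto simp: proper_fun_def effective_domain_def)
  moreover have "\<phi> v + ereal (\<xi> \<bullet> (w - v)) \<le> \<phi> w"
    using assms(2) by (simp add: subdifferential_def)
  ultimately show ?thesis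
    by (cases "\<phi> v") (auto simp: effective_domain_def)
qed

lemma proper_fun_finite:
  assumes "proper_fun \<phi>" and "v \<in> effective_domain \<phi>"
  obtains p where "\<phi> v = ereal p"
  using assms by (cases "\<phi> v") (auto simp: proper_fun_def effective_domain_def)

theorem proposition4p2:
  fixes f :: "'a::{real_inner, complete_space} \<Rightarrow> real"
    and gradf :: "'a \<Rightarrow> 'a"
    and \<phi> :: "'a \<Rightarrow> ereal"
    and h \<gamma> \<beta> L r :: real
    and x v :: "nat \<Rightarrow> 'a"
    and k :: nat
  assumes "h > 0" and "\<gamma> > 0" and "\<beta> \<ge> 0" and "L \<ge> 0"
    and "\<And>z. GDERIV f z :> gradf z"
    and "continuous_on UNIV gradf"
    and "bdd_below (range f)"
    and "L-lipschitz_on UNIV gradf"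
    and "proper_fun \<phi>" and "lower_semicontinuous \<phi>" and "convex_fun \<phi>"
    and "\<phi> 0 = 0" and "\<And>z. \<phi> 0 \<le> \<phi> z"
    and "r > 0" and "cball 0 r \<subseteq> subdifferential \<phi> 0"
    and "\<And>n. 0 \<in> (\<lambda>\<xi>. (v (Suc n) - v n) /\<^sub>R h + \<gamma> *\<^sub>R v (Suc n) + \<xi> + gradf (x n + \<beta> *\<^sub>R v n))
                    ` subdifferential \<phi> (v (Suc n))"
    and "\<And>n. (x (Suc n) - x n) /\<^sub>R h = v (Suc n)"
    and "v k \<in> effective_domain \<phi>"
  shows "energy f \<phi> \<beta> \<gamma> (x (Suc k)) (v (Suc k)) - energy f \<phi> \<beta> \<gamma> (x k) (v k)
           + ereal h * \<phi> (v (Suc k))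
           + ereal (quad_Q L \<beta> \<gamma> h (v (Suc k)) (v (Suc k) - v k)) \<le> 0"
proof -
  define u where "u = v (Suc k)"
  define d where "d = u - v k"
  define y where "y = x k + \<beta> *\<^sub>R v k"
  obtain \<xi> where \<xi>: "\<xi> \<in> subdifferential \<phi> u"
    and incl: "d /\<^sub>R h + \<gamma> *\<^sub>R u + \<xi> + gradf y = 0"
    using assms(16)[of k] by (auto simp: u_def d_def y_def)
  \<comment> \<open>With \<open>p\<close> and \<open>q\<close> real, the extended-real claim reduces
    to a real inequality.\<close>
  obtain p where p: "\<phi> (v k) = ereal p"
    using proper_fun_finite[OF assms(9,18)] .
  obtain q where q: "\<phi> u = ereal q"
    using proper_fun_finite[OF assms(9) subgradient_imp_effective_domain[OF assms(9) \<xi>]] .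
  have sub: "\<phi> u + ereal (\<xi> \<bullet> (w - u)) \<le> \<phi> w" for w
    using \<xi> by (simp add: subdifferential_def)
  have sub0: "q \<le> \<xi> \<bullet> u"
    using sub[of 0] q assms(12) by simp
  have subv: "q - p \<le> \<xi> \<bullet> d"
    using sub[of "v k"] q p by (simp add: d_def inner_diff_right)
  have "x (Suc k) = x k + h *\<^sub>R u"
  proof -
    have "h *\<^sub>R u = x (Suc k) - x k"
      using \<open>h > 0\<close> unfolding u_def assms(17)[of k, symmetric] by simp
    then show ?thesis by simp
  qed
  then have y': "x (Suc k) + \<beta> *\<^sub>R u = y + (h *\<^sub>R u + \<beta> *\<^sub>R d)"
    by (simp add: y_def d_def algebra_simps)
  have gradf_y: "gradf y = - (d /\<^sub>R h) - \<gamma> *\<^sub>R u - \<xi>"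
    using incl by (simp add: algebra_simps eq_neg_iff_add_eq_0)
  have "gradf y \<bullet> (h *\<^sub>R u + \<beta> *\<^sub>R d) = - (u \<bullet> d) - h * \<gamma> * (norm u)\<^sup>2 - h * (\<xi> \<bullet> u)
      - \<beta> / h * (norm d)\<^sup>2 - \<beta> * \<gamma> * (u \<bullet> d) - \<beta> * (\<xi> \<bullet> d)"
    using \<open>h > 0\<close> unfolding gradf_y power2_norm_eq_inner
    by (simp add: inner_simps inner_commute[of d u] field_simps)
  \<comment> \<open>The weights \<open>h\<close> and \<open>\<beta>\<close> are nonnegative:
    \<open>h * q\<close> supplies the dissipation term, and \<open>\<beta> * (q - p)\<close> the
    increment of the potential part of the energy.\<close>
  also have "\<dots> \<le> - (u \<bullet> d) - h * \<gamma> * (norm u)\<^sup>2 - h * q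
      - \<beta> / h * (norm d)\<^sup>2 - \<beta> * \<gamma> * (u \<bullet> d) - \<beta> * (q - p)"
    using mult_left_mono[OF sub0, of h] mult_left_mono[OF subv, of \<beta>] \<open>h > 0\<close> \<open>\<beta> \<ge> 0\<close> by linarith
  finally have force: "gradf y \<bullet> (h *\<^sub>R u + \<beta> *\<^sub>R d) \<le> \<dots>" .
  have norm_step: "(norm (h *\<^sub>R u + \<beta> *\<^sub>R d))\<^sup>2
      = h\<^sup>2 * (norm u)\<^sup>2 + 2 * h * \<beta> * (u \<bullet> d) + \<beta>\<^sup>2 * (norm d)\<^sup>2"
    unfolding power2_norm_eq_inner
    by (simp add: inner_simps inner_commute[of d u] power2_eq_square algebra_simps)
  have kinetic: "(norm (v k))\<^sup>2 = (norm u)\<^sup>2 - 2 * (u \<bullet> d) + (norm d)\<^sup>2"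
    unfolding power2_norm_eq_inner d_def by (simp add: inner_simps inner_commute[of "v k" u])
  \<comment> \<open>In \<open>coeff_C\<close>, \<open>\<beta> / h\<close> comes from
    \<open>force\<close>, \<open>(1 + \<beta> * \<gamma>) / 2\<close> from \<open>kinetic\<close>,
    and the negative part from \<open>norm_step\<close>, which also yields the cross term of
    \<open>quad_Q\<close>.\<close>
  have "f (y + (h *\<^sub>R u + \<beta> *\<^sub>R d)) + (1 + \<beta> * \<gamma>) / 2 * (norm u)\<^sup>2 + \<beta> * q
      - (f y + (1 + \<beta> * \<gamma>) / 2 * (norm (v k))\<^sup>2 + \<beta> * p) + h * q + quad_Q L \<beta> \<gamma> h u d \<le> 0"
  proof -
    \<comment> \<open>Naming the quotient keeps \<open>field_simps\<close> from clearing the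
      denominator \<open>h\<close>.\<close>
    define c where "c = \<beta> / h"
    show ?thesis
      using descent_lemma[OF assms(5,8), of y "h *\<^sub>R u + \<beta> *\<^sub>R d"] force
      unfolding norm_step kinetic quad_Q_def coeff_A_def coeff_C_def c_def[symmetric]
      by (simp add: field_simps)
  qed
  \<comment> \<open>If \<open>\<beta> = 0\<close>, the real terms \<open>\<beta> * p\<close> and
    \<open>\<beta> * q\<close> vanish, matching the omitted term in \<open>energy\<close>.\<close>
  then show ?thesis
    unfolding energy_def u_def[symmetric] d_def[symmetric] y_def[symmetric] y' p q
    by (auto simp: algebra_simps)
qed

end
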